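(* Let $G$ be a topological group, equipped with its left-coarse structure, and let $G\curvearrowright X$ be a coarsely proper action on a pseudometric space $(X,d_X)$ by isometries. For any basepoint $x_0\in X$ and any constant $C>0$, the coarse Dirichlet domain $$D_{x_0}(C)=\{x\in X\mid d_X(x,x_0)\le d_X(x,gx_0)+C\text{ for all }g\in G\}$$ is a coarse fundamental set that satisfies the coarse Koszul condition.
   Context: A pseudometric $d$ is a symmetric, non-negative real-valued function satisfying the triangle inequality and $d(x,x)=0$. The pseudometric space $(X,d_X)$ carries the topology induced by $d_X$ and the coarse structure $\mathcal{E}$ consisting of all subsets (entourages) of the sets $E_r=\{(x,y)\in X\times X\mid d_X(x,y)\le r\}$, $r\ge 0$. A subset $B\subseteq X$ is coarsely bounded if $B\times B\in\mathcal{E}$. For $E\subseteq X\times X$ and $A\subseteq X$, $E[A]=\{x\in X\mid\exists a\in A,\ (x,a)\in E\}$. The left-coarse structure of a topological group $G$ is $\mathcal{E}_{\mathcal{P}}=\{E\subseteq G\times G\mid \forall d\in\mathcal{P},\ \sup_{(x,y)\in E}d(x,y)<\infty\}$, where $\mathcal{P}$ is the family of all continuous left-invariant pseudometrics on $G$; thus $B\subseteq G$ is coarsely bounded iff it has finite diameter for every $d\in\mathcal{P}$. For $A,B\subseteq X$, the transporter is $(A\mid B)_G=\{g\in G\mid gA\cap B\neq\emptyset\}$. The action is coarsely proper if $(B\mid B)_G$ is coarsely bounded in $G$ for every coarsely bounded $B\subseteq X$. A subset $F\subseteq X$ is a coarse fundamental set for the action if $E[GF]=X$ for some $E\in\mathcal{E}$.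 A coarse fundamental set $F$ satisfies the coarse Koszul condition if there exists an entourage $E\in\mathcal{E}$ such that for every coarsely bounded subset $B\subseteq X$, the transporter $(E[F]\mid B)_G$ is a coarsely bounded subset of $G$. *)

theory Defs
  imports "HOL-Algebra.Group_Action" "HOL-Analysis.Product_Topology"
begin

definition pseudometric_on :: "'a set \<Rightarrow> ('a \<Rightarrow> 'a \<Rightarrow> real) \<Rightarrow> bool" where
  "pseudometric_on X d \<longleftrightarrow>
     (\<forall>x\<in>X. d x x = 0) \<and>
     (\<forall>x\<in>X. \<forall>y\<in>X. 0 \<le> d x y \<and> d x y = d y x) \<and>
     (\<forall>x\<in>X. \<forall>y\<in>X. \<forall>z\<in>X. d x z \<le> d x y + d y z)"

text \<open>No separation axiom is imposed on the topology.\<close>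

locale topological_group = group G for G (structure) +
  fixes T :: "'a topology"
  assumes topspace_eq: "topspace T = carrier G"
    and continuous_mult: "continuous_map (prod_topology T T) T (\<lambda>(x, y). x \<otimes> y)"
    and continuous_inv: "continuous_map T T (\<lambda>x. inv x)"

text \<open>A coarse structure is represented by its set of entourages.\<close>

definition metric_coarse_structure ::
    "'a set \<Rightarrow> ('a \<Rightarrow> 'a \<Rightarrow> real) \<Rightarrow> ('a \<times> 'a) set set" where
  "metric_coarse_structure X d =
     {E. \<exists>r\<ge>0. E \<subseteq> {(x, y). x \<in> X \<and> y \<in> X \<and> d x y \<le> r}}"

definition continuous_left_invariant_pseudometrics ::
    "('g, 'm) monoid_scheme \<Rightarrow> 'g topology \<Rightarrow> ('g \<Rightarrow> 'g \<Rightarrow> real) set" where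
  "continuous_left_invariant_pseudometrics G T =
     {d. pseudometric_on (carrier G) d \<and>
         continuous_map (prod_topology T T) euclideanreal (\<lambda>(x, y). d x y) \<and>
         (\<forall>g\<in>carrier G. \<forall>x\<in>carrier G. \<forall>y\<in>carrier G.
            d (g \<otimes>\<^bsub>G\<^esub> x) (g \<otimes>\<^bsub>G\<^esub> y) = d x y)}"

text \<open>Finiteness of the supremum is expressed by \<^const>\<open>bdd_above\<close>, since
  \<^const>\<open>Sup\<close> on the reals is always a real number.\<close>

definition left_coarse_structure ::
    "('g, 'm) monoid_scheme \<Rightarrow> 'g topology \<Rightarrow> ('g \<times> 'g) set set" where
  "left_coarse_structure G T =
     {E. E \<subseteq> carrier G \<times> carrier G \<and>
         (\<forall>d\<in>continuous_left_invariant_pseudometrics G T. bdd_above ((\<lambda>(x, y). d x y) ` E))}"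

text \<open>If all entourages are subsets of \<open>X \<times> X\<close>, then a coarsely bounded set is
  automatically a subset of \<open>X\<close>.\<close>

definition coarsely_bounded :: "('a \<times> 'a) set set \<Rightarrow> 'a set \<Rightarrow> bool" where
  "coarsely_bounded \<E> B \<longleftrightarrow> B \<times> B \<in> \<E>"

text \<open>The set \<open>E[A]\<close>; note that \<open>A\<close> sits in the second coordinate of \<open>E\<close>.\<close>

definition entourage_nbhd :: "'a set \<Rightarrow> ('a \<times> 'a) set \<Rightarrow> 'a set \<Rightarrow> 'a set" where
  "entourage_nbhd X E A = {x \<in> X. \<exists>a\<in>A. (x, a) \<in> E}"

definition transporter ::
    "('g, 'm) monoid_scheme \<Rightarrow> ('g \<Rightarrow> 'x \<Rightarrow> 'x) \<Rightarrow> 'x set \<Rightarrow> 'x set \<Rightarrow> 'g set" where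
  "transporter G \<phi> A B = {g \<in> carrier G. \<phi> g ` A \<inter> B \<noteq> {}}"

definition isometric_action ::
    "('g, 'm) monoid_scheme \<Rightarrow> 'x set \<Rightarrow> ('x \<Rightarrow> 'x \<Rightarrow> real) \<Rightarrow> ('g \<Rightarrow> 'x \<Rightarrow> 'x) \<Rightarrow> bool" where
  "isometric_action G X d \<phi> \<longleftrightarrow>
     group_action G X \<phi> \<and>
     (\<forall>g\<in>carrier G. \<forall>x\<in>X. \<forall>y\<in>X. d (\<phi> g x) (\<phi> g y) = d x y)"

text \<open>In the following definitions \<open>\<E>\<^sub>G\<close> and \<open>\<E>\<close> are the coarse structures on the group
  and on the space \<open>X\<close> it acts on.\<close>

definition coarsely_proper_action ::
    "('g, 'm) monoid_scheme \<Rightarrow> ('g \<times> 'g) set set \<Rightarrow> 'x set \<Rightarrow> ('x \<times> 'x) set set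
      \<Rightarrow> ('g \<Rightarrow> 'x \<Rightarrow> 'x) \<Rightarrow> bool" where
  "coarsely_proper_action G \<E>\<^sub>G X \<E> \<phi> \<longleftrightarrow>
     (\<forall>B\<subseteq>X. coarsely_bounded \<E> B \<longrightarrow> coarsely_bounded \<E>\<^sub>G (transporter G \<phi> B B))"

definition coarse_fundamental_set ::
    "('g, 'm) monoid_scheme \<Rightarrow> 'x set \<Rightarrow> ('x \<times> 'x) set set \<Rightarrow> ('g \<Rightarrow> 'x \<Rightarrow> 'x)
      \<Rightarrow> 'x set \<Rightarrow> bool" where
  "coarse_fundamental_set G X \<E> \<phi> F \<longleftrightarrow>
     F \<subseteq> X \<and> (\<exists>E\<in>\<E>. entourage_nbhd X E (\<Union>g\<in>carrier G. \<phi> g ` F) = X)"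

definition coarse_Koszul ::
    "('g, 'm) monoid_scheme \<Rightarrow> ('g \<times> 'g) set set \<Rightarrow> 'x set \<Rightarrow> ('x \<times> 'x) set set
      \<Rightarrow> ('g \<Rightarrow> 'x \<Rightarrow> 'x) \<Rightarrow> 'x set \<Rightarrow> bool" where
  "coarse_Koszul G \<E>\<^sub>G X \<E> \<phi> F \<longleftrightarrow>
     (\<exists>E\<in>\<E>. \<forall>B\<subseteq>X. coarsely_bounded \<E> B \<longrightarrow>
        coarsely_bounded \<E>\<^sub>G (transporter G \<phi> (entourage_nbhd X E F) B))"

definition coarse_Dirichlet_domain ::
    "('g, 'm) monoid_scheme \<Rightarrow> 'x set \<Rightarrow> ('x \<Rightarrow> 'x \<Rightarrow> real) \<Rightarrow> ('g \<Rightarrow> 'x \<Rightarrow> 'x)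
      \<Rightarrow> 'x \<Rightarrow> real \<Rightarrow> 'x set" where
  "coarse_Dirichlet_domain G X d \<phi> x\<^sub>0 C =
     {x \<in> X. \<forall>g\<in>carrier G. d x x\<^sub>0 \<le> d x (\<phi> g x\<^sub>0) + C}"

end

theory Submission
  imports Defs
begin

text \<open>
  Both halves rest on the identity \<open>d (g\<inverse> x) x\<^sub>0 = d x (g x\<^sub>0)\<close>, valid since the action is
  isometric: moving \<open>x\<close> by the group amounts to measuring its distance to another point of the
  orbit of the basepoint.

  The Dirichlet domain consists of the points for which \<open>x\<^sub>0\<close> is, up to the error \<open>C\<close>, a nearest
  point of the orbit. The distances from \<open>x\<close> to the orbit have an infimum that need not be attained,
  but as \<open>C > 0\<close> some orbit point \<open>g x\<^sub>0\<close> comes within \<open>C\<close> of it, and then \<open>g\<inverse> x\<close> lies in the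
  domain. Hence the translates of the domain cover \<open>X\<close> exactly
  (\<open>coarse_Dirichlet_domain_translates_cover\<close>).

  For the Koszul condition, suppose that \<open>g\<close> moves a point near \<open>a\<close>, with \<open>a\<close> in the domain, into a
  bounded set \<open>B\<close>. Then \<open>g a\<close> is at bounded distance from \<open>x\<^sub>0\<close>. The Dirichlet inequality for \<open>a\<close>
  says that \<open>g a\<close> is, up to \<open>C\<close>, at least as close to \<open>g x\<^sub>0\<close> as to \<open>x\<^sub>0\<close>, so \<open>g x\<^sub>0\<close> is at bounded
  distance from \<open>x\<^sub>0\<close> as well (\<open>coarse_Dirichlet_domain_displacement\<close>). All such \<open>g\<close> therefore
  belong to the transporter of a single ball around \<open>x\<^sub>0\<close>, which is coarsely bounded because the
  action is coarsely proper. This argument works for every entourage, so the Koszul condition can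
  be witnessed by the same entourage that witnesses coarse fundamentality.
\<close>

lemma coarsely_bounded_metric_iff:
  "coarsely_bounded (metric_coarse_structure X d) B \<longleftrightarrow>
     B \<subseteq> X \<and> (\<exists>r\<ge>0. \<forall>x\<in>B. \<forall>y\<in>B. d x y \<le> r)"
  unfolding coarsely_bounded_def metric_coarse_structure_def by fast

lemma coarsely_bounded_left_coarse_structure_subset:
  assumes "coarsely_bounded (left_coarse_structure G T) B" and "A \<subseteq> B"
  shows "coarsely_bounded (left_coarse_structure G T) A"
proof -
  have sub: "A \<times> A \<subseteq> B \<times> B"
    using assms(2) by blast
  then show ?thesis
    using assms(1) unfolding coarsely_bounded_def left_coarse_structure_def
    by (auto intro: bdd_above_mono[OF _ image_mono[OF sub]])
qed

locale isometric_action_on_pseudometric_space =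
  fixes G :: "('g, 'm) monoid_scheme" (structure)
    and X :: "'x set"
    and d :: "'x \<Rightarrow> 'x \<Rightarrow> real"
    and \<phi> :: "'g \<Rightarrow> 'x \<Rightarrow> 'x"
  assumes pseudometric: "pseudometric_on X d"
    and isometric: "isometric_action G X d \<phi>"
begin

sublocale group_action G X \<phi>
  using isometric by (simp add: isometric_action_def)

sublocale group G
  using group_hom by (simp add: group_hom_def)

lemma dist_self: "x \<in> X \<Longrightarrow> d x x = 0"
  and dist_nonneg: "\<lbrakk>x \<in> X; y \<in> X\<rbrakk> \<Longrightarrow> 0 \<le> d x y"
  and dist_commute: "\<lbrakk>x \<in> X; y \<in> X\<rbrakk> \<Longrightarrow> d x y = d y x"
  and dist_triangle: "\<lbrakk>x \<in> X; y \<in> X; z \<in> X\<rbrakk> \<Longrightarrow> d x z \<le> d x y + d y z"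
  using pseudometric unfolding pseudometric_on_def by blast+

lemma dist_action: "\<lbrakk>g \<in> carrier G; x \<in> X; y \<in> X\<rbrakk> \<Longrightarrow> d (\<phi> g x) (\<phi> g y) = d x y"
  using isometric by (simp add: isometric_action_def)

lemma action_closed: "\<lbrakk>g \<in> carrier G; x \<in> X\<rbrakk> \<Longrightarrow> \<phi> g x \<in> X"
  using element_image by blast

lemma action_inv_cancel:
  assumes "g \<in> carrier G" and "x \<in> X"
  shows "\<phi> g (\<phi> (inv g) x) = x"
  using orbit_sym_aux[of "inv g" x "\<phi> (inv g) x"] assms by simp

lemma dist_action_inv:
  assumes "g \<in> carrier G" and "x \<in> X" and "y \<in> X"
  shows "d (\<phi> (inv g) x) y = d x (\<phi> g y)"
  using dist_action[of g "\<phi> (inv g) x" y] action_inv_cancel[of g x] action_closed[of "inv g" x]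
    assms by simp

text \<open>
  The distances to the orbit are bounded below by 0, so they have an infimum, and \<open>C > 0\<close> leaves
  room for a group element that nearly realises it.
\<close>

lemma exists_almost_nearest_orbit_point:
  assumes x: "x \<in> X" and x0: "x\<^sub>0 \<in> X" and C: "C > 0"
  obtains g where "g \<in> carrier G"
    and "\<And>h. h \<in> carrier G \<Longrightarrow> d x (\<phi> g x\<^sub>0) \<le> d x (\<phi> h x\<^sub>0) + C"
proof -
  define S where "S = (\<lambda>h. d x (\<phi> h x\<^sub>0)) ` carrier G"
  have "S \<noteq> {}"
    unfolding S_def by blast
  moreover have bdd: "bdd_below S"
    unfolding S_def by (rule bdd_belowI2[where m = 0]) (simp add: dist_nonneg action_closed x x0)
  ultimately obtain s where "s \<in> S" and s: "s < Inf S + C"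
    using cInf_less_iff[of S "Inf S + C"] C by auto
  then obtain g where g: "g \<in> carrier G" "s = d x (\<phi> g x\<^sub>0)"
    unfolding S_def by blast
  have "d x (\<phi> g x\<^sub>0) \<le> d x (\<phi> h x\<^sub>0) + C" if "h \<in> carrier G" for h
  proof -
    have "Inf S \<le> d x (\<phi> h x\<^sub>0)"
      using that bdd by (auto simp: S_def intro: cInf_lower)
    then show ?thesis
      using s g(2) by linarith
  qed
  then show thesis
    using that g(1) by blast
qed

text \<open>
  If \<open>g x\<^sub>0\<close> is almost nearest to \<open>x\<close> among the points \<open>g h x\<^sub>0\<close> of the orbit, then pulling back by
  \<open>g\<close> makes \<open>x\<^sub>0\<close> almost nearest to \<open>g\<inverse> x\<close> among the points \<open>h x\<^sub>0\<close>.
\<close>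

lemma coarse_Dirichlet_domain_translates_cover:
  assumes x0: "x\<^sub>0 \<in> X" and C: "C > 0"
  shows "(\<Union>g\<in>carrier G. \<phi> g ` coarse_Dirichlet_domain G X d \<phi> x\<^sub>0 C) = X"
proof
  show "(\<Union>g\<in>carrier G. \<phi> g ` coarse_Dirichlet_domain G X d \<phi> x\<^sub>0 C) \<subseteq> X"
    by (auto simp: coarse_Dirichlet_domain_def action_closed)
next
  show "X \<subseteq> (\<Union>g\<in>carrier G. \<phi> g ` coarse_Dirichlet_domain G X d \<phi> x\<^sub>0 C)"
  proof
    fix x assume x: "x \<in> X"
    obtain g where g: "g \<in> carrier G"
      and near: "\<And>h. h \<in> carrier G \<Longrightarrow> d x (\<phi> g x\<^sub>0) \<le> d x (\<phi> h x\<^sub>0) + C"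
      using exists_almost_nearest_orbit_point[OF x x0 C] by blast
    have "d (\<phi> (inv g) x) x\<^sub>0 \<le> d (\<phi> (inv g) x) (\<phi> h x\<^sub>0) + C" if h: "h \<in> carrier G" for h
      using near[of "g \<otimes> h"] g h x x0
      by (simp add: dist_action_inv composition_rule action_closed)
    then have "\<phi> (inv g) x \<in> coarse_Dirichlet_domain G X d \<phi> x\<^sub>0 C"
      using g x by (simp add: coarse_Dirichlet_domain_def action_closed)
    then show "x \<in> (\<Union>g\<in>carrier G. \<phi> g ` coarse_Dirichlet_domain G X d \<phi> x\<^sub>0 C)"
      using g action_inv_cancel[OF g x] by (metis UN_I imageI)
  qed
qed

text \<open>
  No thickening is required when the translates cover \<open>X\<close> exactly, so the diagonal serves as the
  entourage.
\<close>

lemma coarse_fundamental_set_if_translates_cover: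
  assumes "F \<subseteq> X" and cover: "(\<Union>g\<in>carrier G. \<phi> g ` F) = X"
  shows "coarse_fundamental_set G X (metric_coarse_structure X d) \<phi> F"
proof -
  have "Id_on X \<in> metric_coarse_structure X d"
    unfolding metric_coarse_structure_def by (auto simp: dist_self)
  moreover have "entourage_nbhd X (Id_on X) (\<Union>g\<in>carrier G. \<phi> g ` F) = X"
    unfolding cover entourage_nbhd_def by blast
  ultimately show ?thesis
    using assms(1) unfolding coarse_fundamental_set_def by blast
qed

text \<open>
  Go from \<open>x\<^sub>0\<close> to \<open>g x\<^sub>0\<close> through \<open>g a\<close>. The second leg has length \<open>d a x\<^sub>0\<close>, and the Dirichlet
  inequality for \<open>a\<close> and \<open>g\<inverse>\<close> bounds it by the first leg plus \<open>C\<close>.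
\<close>

lemma coarse_Dirichlet_domain_displacement:
  assumes a: "a \<in> coarse_Dirichlet_domain G X d \<phi> x\<^sub>0 C"
    and g: "g \<in> carrier G" and x0: "x\<^sub>0 \<in> X"
  shows "d x\<^sub>0 (\<phi> g x\<^sub>0) \<le> 2 * d x\<^sub>0 (\<phi> g a) + C"
proof -
  have aX: "a \<in> X" and "d a x\<^sub>0 \<le> d a (\<phi> (inv g) x\<^sub>0) + C"
    using a g by (auto simp: coarse_Dirichlet_domain_def)
  moreover have "d a (\<phi> (inv g) x\<^sub>0) = d x\<^sub>0 (\<phi> g a)"
    using dist_action_inv[OF g x0 aX] dist_commute[OF aX action_closed[of "inv g" x\<^sub>0]] g x0
    by simp
  moreover have "d x\<^sub>0 (\<phi> g x\<^sub>0) \<le> d x\<^sub>0 (\<phi> g a) + d a x\<^sub>0"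
    using dist_triangle[of x\<^sub>0 "\<phi> g a" "\<phi> g x\<^sub>0"] dist_action[of g a x\<^sub>0] g x0 aX
    by (simp add: action_closed)
  ultimately show ?thesis
    by linarith
qed

lemma coarsely_bounded_ball:
  assumes x0: "x\<^sub>0 \<in> X"
  shows "coarsely_bounded (metric_coarse_structure X d) {x \<in> X. d x\<^sub>0 x \<le> R}"
proof -
  have "d x y \<le> 2 * \<bar>R\<bar>" if "x \<in> X" "d x\<^sub>0 x \<le> R" "y \<in> X" "d x\<^sub>0 y \<le> R" for x y
    using dist_triangle[of x x\<^sub>0 y] dist_commute[of x x\<^sub>0] that x0 by simp
  then show ?thesis
    unfolding coarsely_bounded_metric_iff by (intro conjI exI[of _ "2 * \<bar>R\<bar>"]) auto
qed

text \<open>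
  Every element of the transporter moves \<open>x\<^sub>0\<close> by a bounded amount, and an element that moves
  \<open>x\<^sub>0\<close> by at most \<open>R\<close> lies in the transporter of the ball of radius \<open>R\<close> around \<open>x\<^sub>0\<close> to itself.
\<close>

lemma coarse_Dirichlet_domain_transporter_subset:
  assumes E: "E \<in> metric_coarse_structure X d"
    and B: "coarsely_bounded (metric_coarse_structure X d) B"
    and x0: "x\<^sub>0 \<in> X" and C: "C > 0"
  obtains R where
    "transporter G \<phi> (entourage_nbhd X E (coarse_Dirichlet_domain G X d \<phi> x\<^sub>0 C)) B
       \<subseteq> transporter G \<phi> {x \<in> X. d x\<^sub>0 x \<le> R} {x \<in> X. d x\<^sub>0 x \<le> R}"
proof (cases "B = {}")
  case True
  then show thesis
    using that by (auto simp: transporter_def)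
next
  case False
  then obtain b where b: "b \<in> B"
    by blast
  obtain r where r: "0 \<le> r" "\<And>x y. (x, y) \<in> E \<Longrightarrow> x \<in> X \<and> y \<in> X \<and> d x y \<le> r"
    using E unfolding metric_coarse_structure_def by blast
  obtain s where BX: "B \<subseteq> X" and s: "0 \<le> s" "\<And>x y. \<lbrakk>x \<in> B; y \<in> B\<rbrakk> \<Longrightarrow> d x y \<le> s"
    using B unfolding coarsely_bounded_metric_iff by blast
  have bX: "b \<in> X"
    using b BX by blast
  \<comment> \<open>The path from \<open>x\<^sub>0\<close> to \<open>g a\<close> runs through \<open>b\<close> and the point of \<open>B\<close> hit by \<open>g\<close>.\<close>
  define R where "R = 2 * (d x\<^sub>0 b + s + r) + C"
  have R: "R \<ge> 0"
    using dist_nonneg[OF x0 bX] s(1) r(1) C by (simp add: R_def)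
  have "g \<in> transporter G \<phi> {x \<in> X. d x\<^sub>0 x \<le> R} {x \<in> X. d x\<^sub>0 x \<le> R}"
    if in_transporter: "g \<in> transporter G \<phi> (entourage_nbhd X E (coarse_Dirichlet_domain G X d \<phi> x\<^sub>0 C)) B" for g
  proof -
    obtain y a where g: "g \<in> carrier G" and yB: "\<phi> g y \<in> B"
      and a: "a \<in> coarse_Dirichlet_domain G X d \<phi> x\<^sub>0 C" and ya: "(y, a) \<in> E"
      using in_transporter unfolding transporter_def entourage_nbhd_def by blast
    have X: "y \<in> X" "a \<in> X" "\<phi> g y \<in> X" "\<phi> g a \<in> X" "\<phi> g x\<^sub>0 \<in> X" and "d y a \<le> r"
      using r(2)[OF ya] g x0 by (auto simp: action_closed)
    then have "d (\<phi> g y) (\<phi> g a) \<le> r"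
      using dist_action[OF g X(1,2)] by simp
    moreover have "d b (\<phi> g y) \<le> s"
      using s(2) b yB by blast
    ultimately have "d x\<^sub>0 (\<phi> g a) \<le> d x\<^sub>0 b + s + r"
      using dist_triangle[OF x0 bX X(4)] dist_triangle[OF bX X(3,4)] by linarith
    then have "d x\<^sub>0 (\<phi> g x\<^sub>0) \<le> R"
      using coarse_Dirichlet_domain_displacement[OF a g x0] by (simp add: R_def)
    moreover have "d x\<^sub>0 x\<^sub>0 \<le> R"
      using dist_self[OF x0] R by simp
    ultimately show ?thesis
      using g x0 X(5) unfolding transporter_def by blast
  qed
  then show thesis
    using that by blast
qed

lemma coarsely_bounded_coarse_Dirichlet_domain_transporter:
  assumes proper: "coarsely_proper_action G (left_coarse_structure G T) X
                     (metric_coarse_structure X d) \<phi>"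
    and E: "E \<in> metric_coarse_structure X d"
    and B: "coarsely_bounded (metric_coarse_structure X d) B"
    and x0: "x\<^sub>0 \<in> X" and C: "C > 0"
  shows "coarsely_bounded (left_coarse_structure G T)
           (transporter G \<phi> (entourage_nbhd X E (coarse_Dirichlet_domain G X d \<phi> x\<^sub>0 C)) B)"
proof -
  obtain R where
    "transporter G \<phi> (entourage_nbhd X E (coarse_Dirichlet_domain G X d \<phi> x\<^sub>0 C)) B
       \<subseteq> transporter G \<phi> {x \<in> X. d x\<^sub>0 x \<le> R} {x \<in> X. d x\<^sub>0 x \<le> R}"
    using coarse_Dirichlet_domain_transporter_subset[OF E B x0 C] by blast
  moreover have "coarsely_bounded (left_coarse_structure G T)
      (transporter G \<phi> {x \<in> X. d x\<^sub>0 x \<le> R} {x \<in> X. d x\<^sub>0 x \<le> R})"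
    using proper[unfolded coarsely_proper_action_def, rule_format, OF _ coarsely_bounded_ball[OF x0]]
    by simp
  ultimately show ?thesis
    by (rule coarsely_bounded_left_coarse_structure_subset[rotated])
qed

end

theorem theorem6p14:
  fixes G :: "('g, 'm) monoid_scheme"
    and T :: "'g topology"
    and X :: "'x set"
    and d :: "'x \<Rightarrow> 'x \<Rightarrow> real"
    and \<phi> :: "'g \<Rightarrow> 'x \<Rightarrow> 'x"
    and x\<^sub>0 :: 'x
    and C :: real
  assumes "topological_group G T"
    and "pseudometric_on X d"
    and "isometric_action G X d \<phi>"
    and "coarsely_proper_action G (left_coarse_structure G T) X (metric_coarse_structure X d) \<phi>"
    and "x\<^sub>0 \<in> X"
    and "C > 0"
  shows "coarse_fundamental_set G X (metric_coarse_structure X d) \<phi>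
           (coarse_Dirichlet_domain G X d \<phi> x\<^sub>0 C) \<and>
         coarse_Koszul G (left_coarse_structure G T) X (metric_coarse_structure X d) \<phi>
           (coarse_Dirichlet_domain G X d \<phi> x\<^sub>0 C)"
proof -
  interpret isometric_action_on_pseudometric_space G X d \<phi>
    using assms(2,3) by unfold_locales
  let ?D = "coarse_Dirichlet_domain G X d \<phi> x\<^sub>0 C"
  have fund: "coarse_fundamental_set G X (metric_coarse_structure X d) \<phi> ?D"
    using coarse_Dirichlet_domain_translates_cover[OF assms(5,6)]
    by (intro coarse_fundamental_set_if_translates_cover) (auto simp: coarse_Dirichlet_domain_def)
  \<comment> \<open>The empty entourage would satisfy the Koszul condition vacuously; the entourage taken here
    is one for which the neighbourhood of the orbit of the domain is all of \<open>X\<close>.\<close>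
  then obtain E where "E \<in> metric_coarse_structure X d"
    and "entourage_nbhd X E (\<Union>g\<in>carrier G. \<phi> g ` ?D) = X"
    unfolding coarse_fundamental_set_def by blast
  then have "coarse_Koszul G (left_coarse_structure G T) X (metric_coarse_structure X d) \<phi> ?D"
    using coarsely_bounded_coarse_Dirichlet_domain_transporter[OF assms(4) _ _ assms(5,6)]
    unfolding coarse_Koszul_def by blast
  with fund show ?thesis
    by blast
qed

end
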